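(* Let $X$ be a real normed space, let $\mathcal K\subset X$ be co-radiant, and suppose that $K:=\operatorname{cone}(\mathcal K)$ is solid. Then the following assertions are equivalent: (i) $\mathcal K$ is regular. (ii) There exist an inner approximating sequence $(K_n)$ for $K$ and $n_0\in\mathbb N$ such that $\mathcal K\cap K_n$ admits a norm-base for every $n\ge n_0$.
   Context: $X$ is a real normed space, $S_X$ its unit sphere, $B_X^\circ$ its open unit ball, $\operatorname{bd}$ denotes boundary. A cone is a nonempty $C\subset X$ with $\alpha C\subset C$ for all $\alpha\ge 0$; cones are assumed nontrivial ($\{0_X\}\subsetneq C\subset X$) unless otherwise stated; a cone is solid if its interior is nonempty. $\operatorname{cone}(A):=\{\lambda a:\lambda\ge 0,\ a\in A\}$. Co-radiant set: $\mathcal K\subset X$ with $\lambda x\in\mathcal K$ for all $x\in\mathcal K$, $\lambda\ge 1$; co-radiant sets are assumed nonempty with $0_X\notin\mathcal K$. Norm-base: for a co-radiant set $\mathcal K$ and $t>0$, $\mathcal K\cap tS_X$ is a norm-base of $\mathcal K$ if for every $x\in\mathcal K$ there exist $y\in\mathcal K\cap tS_X$ and $\lambda>0$ with $x=\lambda y$; $\mathcal K$ admits a norm-base if this holds for some $t>0$. Interior reductions: for a cone $K$ and $\varepsilon>0$, $K^{-\varepsilon}:=K\setminus\bigl(\operatorname{cone}((\operatorname{bd}K\cap S_X)+\varepsilon B_X^\circ)\setminus\{0_X\}\bigr)$ (a cone, possibly trivial). For co-radiant $\mathcal K$, $\mathcal K^{-\varepsilon}:=\mathcal K\cap(\operatorname{cone}(\mathcal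 K))^{-\varepsilon}$. $\mathcal K$ is regular if, for every $\varepsilon>0$ with $\mathcal K^{-\varepsilon}\neq\varnothing$, the set $\mathcal K^{-\varepsilon}$ admits a norm-base. Inner approximating sequence: a sequence $(K_n)$ of cones is an inner approximating sequence for a cone $K$ if (i) $K_n\subset K_{n+1}\subset K$ for every $n\in\mathbb N$, and (ii) for every $\varepsilon>0$ there is $n_\varepsilon\in\mathbb N$ with $K^{-\varepsilon}\subset K_n$ for all $n\ge n_\varepsilon$. *)

theory Defs
  imports "HOL-Analysis.Analysis"
begin

text \<open>The library's \<^const>\<open>cone\<close> admits the empty set and \<open>{0}\<close>; a nontrivial cone is
  allowed to be the whole space.\<close>

definition nontrivial_cone :: "'a::real_normed_vector set \<Rightarrow> bool" where
  "nontrivial_cone C \<longleftrightarrow> cone C \<and> {0} \<subset> C"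

definition cone_gen :: "'a::real_normed_vector set \<Rightarrow> 'a set" where
  "cone_gen A = {l *\<^sub>R a | l a. 0 \<le> l \<and> a \<in> A}"

lemma cone_gen_eq_cone_hull: "cone_gen A = cone hull A"
  unfolding cone_gen_def cone_hull_expl by blast

definition solid :: "'a::real_normed_vector set \<Rightarrow> bool" where
  "solid C \<longleftrightarrow> interior C \<noteq> {}"

definition co_radiant :: "'a::real_normed_vector set \<Rightarrow> bool" where
  "co_radiant M \<longleftrightarrow> M \<noteq> {} \<and> 0 \<notin> M \<and> (\<forall>x\<in>M. \<forall>l\<ge>1. l *\<^sub>R x \<in> M)"

definition norm_base :: "'a::real_normed_vector set \<Rightarrow> real \<Rightarrow> bool" where
  "norm_base M t \<longleftrightarrow> (\<forall>x\<in>M. \<exists>y\<in>M \<inter> sphere 0 t. \<exists>l>0. x = l *\<^sub>R y)"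

text \<open>Vacuously true for \<open>M = {}\<close>, but only meant for co-radiant, hence nonempty, \<open>M\<close>.\<close>

definition admits_norm_base :: "'a::real_normed_vector set \<Rightarrow> bool" where
  "admits_norm_base M \<longleftrightarrow> (\<exists>t>0. norm_base M t)"

definition cone_reduction :: "'a::real_normed_vector set \<Rightarrow> real \<Rightarrow> 'a set" where
  "cone_reduction K \<epsilon> =
     K - (cone_gen {b + \<epsilon> *\<^sub>R u | b u. b \<in> frontier K \<inter> sphere 0 1 \<and> u \<in> ball 0 1} - {0})"

definition co_radiant_reduction :: "'a::real_normed_vector set \<Rightarrow> real \<Rightarrow> 'a set" where
  "co_radiant_reduction M \<epsilon> = M \<inter> cone_reduction (cone_gen M) \<epsilon>"

definition regular_co_radiant :: "'a::real_normed_vector set \<Rightarrow> bool" where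
  "regular_co_radiant M \<longleftrightarrow>
     (\<forall>\<epsilon>>0. co_radiant_reduction M \<epsilon> \<noteq> {} \<longrightarrow> admits_norm_base (co_radiant_reduction M \<epsilon>))"

text \<open>Nontriviality of the approximating cones guarantees that, for \<open>K = cone_gen M\<close> with \<open>M\<close>
  co-radiant, every \<open>M \<inter> C n\<close> is nonempty and hence again co-radiant.\<close>

definition inner_approximating_sequence ::
    "(nat \<Rightarrow> 'a::real_normed_vector set) \<Rightarrow> 'a set \<Rightarrow> bool" where
  "inner_approximating_sequence C K \<longleftrightarrow>
     (\<forall>n. nontrivial_cone (C n)) \<and>
     (\<forall>n. C n \<subseteq> C (Suc n) \<and> C (Suc n) \<subseteq> K) \<and>
     (\<forall>\<epsilon>>0. \<exists>n\<^sub>\<epsilon>. \<forall>n\<ge>n\<^sub>\<epsilon>. cone_reduction K \<epsilon> \<subseteq> C n)"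

end

theory Submission
  imports Defs
begin

text \<open>Write \<open>K = cone_gen M\<close>. Everything rests on the reductions of \<open>K\<close> being cones that grow
  as \<open>\<epsilon>\<close> shrinks.

  If \<open>M\<close> is regular, the reductions \<open>cone_reduction K (1 / (n + N))\<close> themselves approximate \<open>K\<close>
  from inside, and their traces on \<open>M\<close> are exactly the sets that regularity speaks about. Solidity
  enters only in the choice of \<open>N\<close>: a nonzero interior point of \<open>K\<close> has a positive distance from
  the frontier, so it survives all reductions with small \<open>\<epsilon>\<close>
  (\<open>interior_in_cone_reduction\<close>), which makes these cones nontrivial.

  Conversely, a reduction of \<open>K\<close> is contained in \<open>C n\<close> for large \<open>n\<close>, and a norm-base is
  inherited by the intersection with a cone (\<open>admits_norm_base_Int_cone\<close>): the base point
  assigned to \<open>x\<close> is a positive multiple of \<open>x\<close>, so it stays in every cone containing \<open>x\<close>.\<close>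

lemma cone_cone_gen: "cone (cone_gen M)"
  by (simp add: cone_gen_eq_cone_hull cone_cone_hull)

lemma zero_in_cone_gen: "M \<noteq> {} \<Longrightarrow> 0 \<in> cone_gen M"
  unfolding cone_gen_def by force

lemma subset_cone_gen: "M \<subseteq> cone_gen M"
  by (simp add: cone_gen_eq_cone_hull hull_subset)

lemma cone_gen_mono: "A \<subseteq> B \<Longrightarrow> cone_gen A \<subseteq> cone_gen B"
  unfolding cone_gen_def by blast

lemma cone_reduction_subset: "cone_reduction K \<epsilon> \<subseteq> K"
  unfolding cone_reduction_def by blast

lemma cone_Diff_cone:
  fixes K D :: "'a::real_normed_vector set"
  assumes "cone K" "cone D"
  shows "cone (K - (D - {0}))"
  unfolding cone_def
proof (intro ballI allI impI)
  fix x and c :: real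
  assume x: "x \<in> K - (D - {0})" and c: "0 \<le> c"
  have "c *\<^sub>R x \<in> K"
    using x c assms(1) by (simp add: cone_def)
  moreover have "c *\<^sub>R x \<notin> D - {0}"
  proof
    assume a: "c *\<^sub>R x \<in> D - {0}"
    then have "c > 0" using c by (cases "c = 0") auto
    then have "(1 / c) *\<^sub>R c *\<^sub>R x \<in> D"
      using a assms(2) unfolding cone_def by (metis DiffD1 divide_nonneg_pos zero_le_one)
    then show False
      using x a \<open>c > 0\<close> by auto
  qed
  ultimately show "c *\<^sub>R x \<in> K - (D - {0})" by blast
qed

lemma cone_cone_reduction: "cone K \<Longrightarrow> cone (cone_reduction K \<epsilon>)"
  unfolding cone_reduction_def by (intro cone_Diff_cone cone_cone_gen)

lemma cone_reduction_antimono: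
  assumes "0 < \<delta>" "\<delta> \<le> \<epsilon>"
  shows "cone_reduction K \<epsilon> \<subseteq> cone_reduction K \<delta>"
proof -
  have "\<exists>b' u'. b + \<delta> *\<^sub>R u = b' + \<epsilon> *\<^sub>R u' \<and> b' \<in> frontier K \<inter> sphere 0 1 \<and> u' \<in> ball 0 1"
    if "b \<in> frontier K \<inter> sphere 0 1" "u \<in> ball 0 1" for b u
  proof (intro exI conjI)
    show "b + \<delta> *\<^sub>R u = b + \<epsilon> *\<^sub>R ((\<delta> / \<epsilon>) *\<^sub>R u)"
      using assms by simp
    have "(\<delta> / \<epsilon>) * norm u \<le> norm u"
      using assms by (intro mult_left_le_one_le) auto
    also have "norm u < 1"
      using that by simp
    finally show "(\<delta> / \<epsilon>) *\<^sub>R u \<in> ball 0 1"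
      using assms by simp
  qed (use that in auto)
  then have "{b + \<delta> *\<^sub>R u | b u. b \<in> frontier K \<inter> sphere 0 1 \<and> u \<in> ball 0 1}
      \<subseteq> {b + \<epsilon> *\<^sub>R u | b u. b \<in> frontier K \<inter> sphere 0 1 \<and> u \<in> ball 0 1}"
    by (smt (verit) Collect_mono_iff)
  from cone_gen_mono[OF this] show ?thesis
    unfolding cone_reduction_def by blast
qed

lemma interior_cone_scaleR:
  fixes K :: "'a::real_normed_vector set"
  assumes "cone K" "x \<in> interior K" "c > 0"
  shows "c *\<^sub>R x \<in> interior K"
proof (rule interiorI)
  show "open ((*\<^sub>R) c ` interior K)"
    using assms by (intro open_scaling) auto
  show "c *\<^sub>R x \<in> (*\<^sub>R) c ` interior K"
    using assms by blast
  show "(*\<^sub>R) c ` interior K \<subseteq> K"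
    using assms interior_subset unfolding cone_def by fastforce
qed

text \<open>A point removed by the reduction has the form \<open>x = l *\<^sub>R (b + \<epsilon> *\<^sub>R u)\<close> with \<open>b\<close> a unit
  vector in the frontier. Then \<open>l *\<^sub>R b\<close> is a frontier point within \<open>l * \<epsilon>\<close> of \<open>x\<close>, and
  \<open>l\<close> is at most \<open>2 * norm x\<close> once \<open>\<epsilon> \<le> 1 / 2\<close>; for small \<open>\<epsilon>\<close> this contradicts the
  distance of an interior point to the frontier.\<close>

lemma interior_in_cone_reduction:
  fixes K :: "'a::real_normed_vector set"
  assumes "cone K" "x \<in> interior K" "x \<noteq> 0"
  obtains \<epsilon> where "\<epsilon> > 0" "x \<in> cone_reduction K \<epsilon>"
proof -
  obtain r where r: "r > 0" "ball x r \<subseteq> K"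
    using assms(2) mem_interior by blast
  then have ball_interior: "ball x r \<subseteq> interior K"
    by (simp add: interior_maximal)
  define \<epsilon> where "\<epsilon> = min (1/2) (r / (2 * norm x))"
  have \<epsilon>: "\<epsilon> > 0" "\<epsilon> \<le> 1/2" "2 * norm x * \<epsilon> \<le> r"
    using r assms(3) by (auto simp: \<epsilon>_def min_def field_simps)
  have "x \<notin> cone_gen {b + \<epsilon> *\<^sub>R u | b u. b \<in> frontier K \<inter> sphere 0 1 \<and> u \<in> ball 0 1}"
  proof
    assume "x \<in> cone_gen {b + \<epsilon> *\<^sub>R u | b u. b \<in> frontier K \<inter> sphere 0 1 \<and> u \<in> ball 0 1}"
    then obtain l b u where l: "0 \<le> l" and x: "x = l *\<^sub>R (b + \<epsilon> *\<^sub>R u)"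
      and b: "b \<in> frontier K" "norm b = 1" and u: "norm u < 1"
      unfolding cone_gen_def by auto
    have "l > 0" using l x assms(3) by (cases "l = 0") auto
    have "norm (\<epsilon> *\<^sub>R u) \<le> 1/2"
      using \<epsilon> u mult_mono[of \<epsilon> "1/2" "norm u" 1] by simp
    then have "1/2 \<le> norm (b + \<epsilon> *\<^sub>R u)"
      using b norm_diff_ineq[of b "\<epsilon> *\<^sub>R u"] by linarith
    then have "l * (1/2) \<le> norm x"
      using l mult_left_mono[of "1/2" "norm (b + \<epsilon> *\<^sub>R u)" l] unfolding x by simp
    then have "l * \<epsilon> \<le> 2 * norm x * \<epsilon>"
      using \<epsilon>(1) by (intro mult_right_mono) auto
    with \<epsilon>(3) have l_bound: "l * \<epsilon> \<le> r" by linarith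
    have "dist x (l *\<^sub>R b) = l * \<epsilon> * norm u"
      using l \<epsilon> x by (simp add: dist_norm scaleR_add_right)
    also have "\<dots> < l * \<epsilon>"
      using \<open>l > 0\<close> \<epsilon> u by simp
    finally have "l *\<^sub>R b \<in> interior K"
      using l_bound ball_interior by (auto simp: subset_iff)
    from interior_cone_scaleR[OF assms(1) this, of "1 / l"] have "b \<in> interior K"
      using \<open>l > 0\<close> by simp
    then show False
      using b by (simp add: frontier_def)
  qed
  then have "x \<in> cone_reduction K \<epsilon>"
    using assms(2) interior_subset unfolding cone_reduction_def by blast
  with \<epsilon>(1) show thesis by (rule that)
qed

text \<open>If the interior point given by solidity is the origin, a small multiple of any nonzero
  vector of \<open>K\<close> replaces it.\<close>

lemma solid_nonzero_interior:
  fixes K :: "'a::real_normed_vector set"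
  assumes "solid K" "m \<in> K" "m \<noteq> 0"
  obtains x where "x \<in> interior K" "x \<noteq> 0"
proof -
  obtain y where y: "y \<in> interior K"
    using assms(1) unfolding solid_def by blast
  show thesis
  proof (cases "y = 0")
    case True
    then obtain r where r: "r > 0" "ball 0 r \<subseteq> interior K"
      using y open_contains_ball[of "interior K"] by auto
    have "(r / 2 / norm m) *\<^sub>R m \<in> ball 0 r"
      using r assms(3) by simp
    then show thesis
      using r assms(3) by (intro that[of "(r / 2 / norm m) *\<^sub>R m"]) auto
  qed (use y that in blast)
qed

lemma inner_approximating_sequence_cone_reduction:
  assumes "cone K" "0 \<in> K" "\<epsilon>\<^sub>0 > 0" "x \<in> cone_reduction K \<epsilon>\<^sub>0" "x \<noteq> 0"
  obtains N :: nat where "N > 0"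
    "inner_approximating_sequence (\<lambda>n. cone_reduction K (1 / real (n + N))) K"
proof -
  obtain N :: nat where N: "N > 0" "1 / real N < \<epsilon>\<^sub>0"
    using assms(3) nat_approx_posE[of \<epsilon>\<^sub>0] by (metis zero_less_Suc)
  have small: "1 / real (n + N) \<le> 1 / real k" if "k > 0" "k \<le> n + N" for n k
    using that by (simp add: frac_le)
  have "nontrivial_cone (cone_reduction K (1 / real (n + N)))" for n
  proof -
    have "1 / real (n + N) \<le> \<epsilon>\<^sub>0"
      using small[of N n] N by simp
    then have "x \<in> cone_reduction K (1 / real (n + N))"
      using assms(4) N cone_reduction_antimono[of "1 / real (n + N)" \<epsilon>\<^sub>0 K] by auto
    moreover have "0 \<in> cone_reduction K (1 / real (n + N))"
      using assms(2) unfolding cone_reduction_def by simp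
    ultimately show ?thesis
      using assms(1,5) cone_cone_reduction unfolding nontrivial_cone_def by blast
  qed
  moreover have "cone_reduction K (1 / real (n + N)) \<subseteq> cone_reduction K (1 / real (Suc n + N))" for n
    using N small[of "n + N" "Suc n"] by (intro cone_reduction_antimono) auto
  moreover have "\<exists>n\<^sub>0. \<forall>n\<ge>n\<^sub>0. cone_reduction K \<epsilon> \<subseteq> cone_reduction K (1 / real (n + N))"
    if pos: "\<epsilon> > 0" for \<epsilon>
  proof -
    obtain k :: nat where k: "k > 0" "1 / real k < \<epsilon>"
      using pos nat_approx_posE[of \<epsilon>] by (metis zero_less_Suc)
    have "cone_reduction K \<epsilon> \<subseteq> cone_reduction K (1 / real (n + N))" if "n \<ge> k" for n
    proof (rule cone_reduction_antimono)
      show "0 < 1 / real (n + N)" using N by simp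
      show "1 / real (n + N) \<le> \<epsilon>" using small[of k n] k that by simp
    qed
    then show ?thesis by blast
  qed
  ultimately have "inner_approximating_sequence (\<lambda>n. cone_reduction K (1 / real (n + N))) K"
    unfolding inner_approximating_sequence_def using cone_reduction_subset by blast
  with N(1) show thesis by (rule that)
qed

lemma admits_norm_base_Int_cone:
  fixes C :: "'a::real_normed_vector set"
  assumes "admits_norm_base A" "cone C"
  shows "admits_norm_base (A \<inter> C)"
proof -
  obtain t where t: "t > 0" "norm_base A t"
    using assms(1) unfolding admits_norm_base_def by blast
  have "\<exists>y\<in>(A \<inter> C) \<inter> sphere 0 t. \<exists>l>0. x = l *\<^sub>R y" if x: "x \<in> A \<inter> C" for x
  proof -
    obtain y l where y: "y \<in> A \<inter> sphere 0 t" "l > 0" "x = l *\<^sub>R y"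
      using t(2) x unfolding norm_base_def by blast
    then have "y = (1 / l) *\<^sub>R x" by simp
    then have "y \<in> C"
      using assms(2) x y(2) unfolding cone_def by simp
    then show ?thesis using y by blast
  qed
  then show ?thesis
    using t(1) unfolding admits_norm_base_def norm_base_def by blast
qed

theorem proposition4p3:
  fixes M :: "'a::real_normed_vector set"
  assumes "co_radiant M"
    and "solid (cone_gen M)"
  shows "regular_co_radiant M \<longleftrightarrow>
    (\<exists>C n0. inner_approximating_sequence C (cone_gen M) \<and>
       (\<forall>n\<ge>n0. admits_norm_base (M \<inter> C n)))"
proof
  assume reg: "regular_co_radiant M"
  obtain m where m: "m \<in> M" "m \<noteq> 0"
    using assms(1) unfolding co_radiant_def by blast
  then have "m \<in> cone_gen M" and zero: "0 \<in> cone_gen M"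
    using subset_cone_gen zero_in_cone_gen by blast+
  then obtain x where x: "x \<in> interior (cone_gen M)" "x \<noteq> 0"
    using solid_nonzero_interior assms(2) m(2) by blast
  then obtain \<epsilon>\<^sub>0 where "\<epsilon>\<^sub>0 > 0" "x \<in> cone_reduction (cone_gen M) \<epsilon>\<^sub>0"
    using interior_in_cone_reduction cone_cone_gen by blast
  then obtain N :: nat where N: "N > 0" "inner_approximating_sequence
      (\<lambda>n. cone_reduction (cone_gen M) (1 / real (n + N))) (cone_gen M)"
    using inner_approximating_sequence_cone_reduction cone_cone_gen zero x(2) by blast
  have "admits_norm_base (M \<inter> cone_reduction (cone_gen M) (1 / real (n + N)))" for n
  proof (cases "M \<inter> cone_reduction (cone_gen M) (1 / real (n + N)) = {}")
    case True
    then show ?thesis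
      unfolding admits_norm_base_def norm_base_def by (auto intro: exI[of _ 1])
  next
    case False
    then show ?thesis
      using reg N(1) unfolding regular_co_radiant_def co_radiant_reduction_def by simp
  qed
  with N(2) show "\<exists>C n0. inner_approximating_sequence C (cone_gen M) \<and>
       (\<forall>n\<ge>n0. admits_norm_base (M \<inter> C n))"
    by blast
next
  assume "\<exists>C n0. inner_approximating_sequence C (cone_gen M) \<and>
       (\<forall>n\<ge>n0. admits_norm_base (M \<inter> C n))"
  then obtain C n0 where C: "inner_approximating_sequence C (cone_gen M)"
    and base: "\<And>n. n \<ge> n0 \<Longrightarrow> admits_norm_base (M \<inter> C n)" by blast
  show "regular_co_radiant M"
    unfolding regular_co_radiant_def co_radiant_reduction_def
  proof (intro allI impI)
    fix \<epsilon> :: real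
    assume "\<epsilon> > 0"
    then obtain k where "\<forall>n\<ge>k. cone_reduction (cone_gen M) \<epsilon> \<subseteq> C n"
      using C unfolding inner_approximating_sequence_def by blast
    then have sub: "cone_reduction (cone_gen M) \<epsilon> \<subseteq> C (max k n0)" by simp
    have "admits_norm_base ((M \<inter> C (max k n0)) \<inter> cone_reduction (cone_gen M) \<epsilon>)"
      by (intro admits_norm_base_Int_cone base cone_cone_reduction cone_cone_gen) simp
    moreover have "(M \<inter> C (max k n0)) \<inter> cone_reduction (cone_gen M) \<epsilon>
        = M \<inter> cone_reduction (cone_gen M) \<epsilon>"
      using sub by blast
    ultimately show "admits_norm_base (M \<inter> cone_reduction (cone_gen M) \<epsilon>)" by simp
  qed
qed

end
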